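(* Let $(X_t)_{t\ge 0}$ be a pure jump subordinator and suppose that, for some finite $\gamma>0$, $-t\log X_t\Rightarrow E_\gamma$ as $t\downarrow 0$. Then, as $t\downarrow 0$, the finite dimensional distributions of $(-t\log X_{ts})_{s>0}$ converge to those of the extremal process $(\widehat\eta_s)_{s>0}$ with parameter $\gamma$. That is, for every $n\ge1$ and all $0=s_0<s_1<s_2<\dots<s_n$, $$\left(-t\log X_{s_1t},-t\log X_{s_2t},\ldots,-t\log X_{s_nt}\right)\Rightarrow\frac1\gamma\left(\bigwedge_{i=1}^k\frac{Z_i}{s_i-s_{i-1}}\right)_{1\le k\le n}\quad\text{as } t\downarrow0,$$ where $Z_1,Z_2,\dots$ are i.i.d. exponential random variables with mean $1$.
   Context: A pure jump subordinator is a nondecreasing càdlàg Lévy process with $X_0=0$ and $\mathbb{E}(e^{-uX_t})=e^{-t\varphi(u)}$ for $u\ge0$, where $\varphi(u)=\int_0^\infty(1-e^{-ux})\,\nu(dx)$ (no drift) and $\nu$ is a measure with $\nu(-\infty,0]=0$, $\nu(1,\infty)<\infty$ and $\int_{(0,1]}u\,\nu(du)<\infty$. $\Rightarrow$ denotes convergence in distribution, $\bigwedge$ denotes minimum, and $E_\gamma$ is an exponential random variable with mean $1/\gamma$. Under the stated hypothesis $X_t>0$ almost surely for each $t>0$, so $-t\log X_{ts}$ is well defined for $s,t>0$. The extremal process with parameter $\gamma$ is the (unique in law) process $(\widehat\eta_s)_{s>0}$ with nonincreasing, piecewise constant càdlàg paths such that for all $0=s_0<s_1<\dots<s_n$, $(\widehat\eta_{s_1},\dots,\widehat\eta_{s_n})$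 has the same distribution as $\left(\frac1\gamma\bigwedge_{i=1}^k\frac{Z_i}{s_i-s_{i-1}}\right)_{1\le k\le n}$. *)

theory Defs
  imports "HOL-Probability.Probability"
begin

text \<open>
  Weak convergence of Borel probability measures on a topological space along a filter. The
  library's \<open>weak_conv\<close> only treats sequences of measures on the real line.
\<close>

definition converges_weakly ::
    "'b topology \<Rightarrow> ('i \<Rightarrow> 'b measure) \<Rightarrow> 'b measure \<Rightarrow> 'i filter \<Rightarrow> bool"
  where "converges_weakly T \<mu> \<nu> F \<longleftrightarrow>
    (\<forall>f :: 'b \<Rightarrow> real. continuous_map T euclideanreal f \<and> bounded (f ` topspace T) \<longrightarrow>
      ((\<lambda>t. \<integral>x. f x \<partial>(\<mu> t)) \<longlongrightarrow> (\<integral>x. f x \<partial>\<nu>)) F)"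

text \<open>
  \<open>n\<close>-dimensional space is the set of extensional functions on \<open>{1..n}\<close>, with the product topology
  and the product Borel sigma-algebra.
\<close>

abbreviation Rn_top :: "nat \<Rightarrow> (nat \<Rightarrow> real) topology"
  where "Rn_top n \<equiv> product_topology (\<lambda>_. euclideanreal) {1..n}"

abbreviation Rn_borel :: "nat \<Rightarrow> (nat \<Rightarrow> real) measure"
  where "Rn_borel n \<equiv> Pi\<^sub>M {1..n} (\<lambda>_. borel)"

definition fin_dim_distr ::
    "'a measure \<Rightarrow> (real \<Rightarrow> 'a \<Rightarrow> real) \<Rightarrow> nat \<Rightarrow> (nat \<Rightarrow> real) \<Rightarrow> (nat \<Rightarrow> real) measure"
  where "fin_dim_distr M Y n s = distr M (Rn_borel n) (\<lambda>\<omega>. \<lambda>k\<in>{1..n}. Y (s k) \<omega>)"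

definition cadlag_on :: "real set \<Rightarrow> (real \<Rightarrow> real) \<Rightarrow> bool"
  where "cadlag_on I f \<longleftrightarrow>
    (\<forall>t\<in>I. (f \<longlongrightarrow> f t) (at t within (I \<inter> {t<..})) \<and>
           (\<exists>l. (f \<longlongrightarrow> l) (at t within (I \<inter> {..<t}))))"

text \<open>
  A real-valued Levy process indexed by \<open>t \<ge> 0\<close>; the values at negative times are irrelevant.
  Stochastic continuity is not listed: it follows from stationary increments and the cadlag paths.
\<close>

definition levy_process :: "'a measure \<Rightarrow> (real \<Rightarrow> 'a \<Rightarrow> real) \<Rightarrow> bool"
  where "levy_process M X \<longleftrightarrow>
    prob_space M \<and>
    (\<forall>t\<ge>0. X t \<in> borel_measurable M) \<and>
    (AE \<omega> in M. X 0 \<omega> = 0) \<and>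
    (AE \<omega> in M. cadlag_on {0..} (\<lambda>t. X t \<omega>)) \<and>
    (\<forall>n. \<forall>t :: nat \<Rightarrow> real. 0 \<le> t 0 \<and> strict_mono_on {0..n} t \<longrightarrow>
      prob_space.indep_vars M (\<lambda>_. borel) (\<lambda>i \<omega>. X (t (Suc i)) \<omega> - X (t i) \<omega>) {..<n}) \<and>
    (\<forall>t\<ge>0. \<forall>h\<ge>0. distr M borel (\<lambda>\<omega>. X (t + h) \<omega> - X t \<omega>) = distr M borel (X h))"

definition subordinator_levy_measure :: "real measure \<Rightarrow> bool"
  where "subordinator_levy_measure \<nu> \<longleftrightarrow>
    sets \<nu> = sets borel \<and>
    emeasure \<nu> {..0} = 0 \<and>
    emeasure \<nu> {1<..} < \<infinity> \<and>
    (\<integral>\<^sup>+u\<in>{0<..1}. ennreal u \<partial>\<nu>) < \<infinity>"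

definition laplace_exponent :: "real measure \<Rightarrow> real \<Rightarrow> real"
  where "laplace_exponent \<nu> u = (LINT x:{0<..}|\<nu>. 1 - exp (- u * x))"

definition pure_jump_subordinator :: "'a measure \<Rightarrow> (real \<Rightarrow> 'a \<Rightarrow> real) \<Rightarrow> bool"
  where "pure_jump_subordinator M X \<longleftrightarrow>
    levy_process M X \<and>
    (AE \<omega> in M. mono_on {0..} (\<lambda>t. X t \<omega>)) \<and>
    (\<exists>\<nu>. subordinator_levy_measure \<nu> \<and>
      (\<forall>t\<ge>0. \<forall>u\<ge>0. (\<integral>\<omega>. exp (- u * X t \<omega>) \<partial>M) = exp (- t * laplace_exponent \<nu> u)))"

text \<open>
  The parameter of \<open>exponential_density\<close> is the rate, so \<open>exp_law \<gamma>\<close> has mean \<open>1 / \<gamma>\<close>.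
\<close>

definition exp_law :: "real \<Rightarrow> real measure"
  where "exp_law \<gamma> = density lborel (exponential_density \<gamma>)"

definition extremal_vector :: "real \<Rightarrow> nat \<Rightarrow> (nat \<Rightarrow> real) \<Rightarrow> (nat \<Rightarrow> real) \<Rightarrow> nat \<Rightarrow> real"
  where "extremal_vector \<gamma> n s z =
    (\<lambda>k\<in>{1..n}. 1 / \<gamma> * (MIN i\<in>{1..k}. z i / (s i - s (i - 1))))"

text \<open>
  Pieces of a path on \<open>{0<..}\<close> may accumulate at \<open>0\<close> and at infinity, so finiteness of the set
  \<open>D\<close> of break points is required only on compact subintervals.
\<close>

definition piecewise_constant_on_pos :: "(real \<Rightarrow> real) \<Rightarrow> bool"
  where "piecewise_constant_on_pos f \<longleftrightarrow>
    (\<forall>a b. 0 < a \<and> a < b \<longrightarrow>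
      (\<exists>D. finite D \<and>
        (\<forall>u v. a \<le> u \<and> u \<le> v \<and> v \<le> b \<and> {u..v} \<inter> D = {} \<longrightarrow> f u = f v)))"

text \<open>
  The coordinates of the product measure below are the i.i.d. standard exponential variables of
  the description of the finite-dimensional laws.
\<close>

definition extremal_process :: "real \<Rightarrow> 'a measure \<Rightarrow> (real \<Rightarrow> 'a \<Rightarrow> real) \<Rightarrow> bool"
  where "extremal_process \<gamma> M \<eta> \<longleftrightarrow>
    prob_space M \<and>
    (\<forall>s>0. \<eta> s \<in> borel_measurable M) \<and>
    (AE \<omega> in M. antimono_on {0<..} (\<lambda>s. \<eta> s \<omega>) \<and>
       piecewise_constant_on_pos (\<lambda>s. \<eta> s \<omega>) \<and> cadlag_on {0<..} (\<lambda>s. \<eta> s \<omega>)) \<and>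
    (\<forall>n\<ge>1. \<forall>s :: nat \<Rightarrow> real. s 0 = 0 \<and> strict_mono_on {0..n} s \<longrightarrow>
      fin_dim_distr M \<eta> n s =
        distr (Pi\<^sub>M {1..n} (\<lambda>_. exp_law 1)) (Rn_borel n) (extremal_vector \<gamma> n s))"

text \<open>
  Here \<open>ln 0 = 0\<close>, but this does not matter for limits as \<open>t\<close> decreases to \<open>0\<close>: if \<open>X t = 0\<close> has
  positive probability for some \<open>t > 0\<close>, then the Levy measure is finite and \<open>X t = 0\<close> with
  probability tending to \<open>1\<close> as \<open>t\<close> decreases to \<open>0\<close>. Then \<open>- t * ln (X t)\<close> tends to \<open>0\<close> in
  probability (with \<open>- ln 0 = \<infinity>\<close> it would tend to \<open>\<infinity>\<close>), so it has no exponential limit under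
  either convention. Convergence to an exponential law thus implies \<open>X t > 0\<close> almost surely.
\<close>

definition log_scaled :: "(real \<Rightarrow> 'a \<Rightarrow> real) \<Rightarrow> real \<Rightarrow> real \<Rightarrow> 'a \<Rightarrow> real"
  where "log_scaled X t s \<omega> = - t * ln (X (t * s) \<omega>)"

end

theory Submission
  imports Defs
begin

text \<open>
  The increments of \<open>X\<close> over the intervals from \<open>t s\<^sub>i\<close> to \<open>t s\<^sub>i\<^sub>+\<^sub>1\<close> are independent, and by stationarity
  \<open>- t\<close> times the logarithm of such an increment converges to an exponential variable divided by
  \<open>s\<^sub>i\<^sub>+\<^sub>1 - s\<^sub>i\<close>. The value of \<open>X\<close> at \<open>t s\<^sub>k\<close> is a sum of increments, and at this logarithmic scale a sum is
  governed by its largest term: \<open>- t ln (\<Sum> exp (- w\<^sub>i / t))\<close> differs from \<open>Min w\<^sub>i\<close> by at most \<open>t ln k\<close>.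
  Increments that vanish are negligible because the exponential law has no mass in \<open>{..0}\<close>.
\<close>

section \<open>Measurability and laws on product spaces\<close>

text \<open>Precomposing with the restriction to \<open>I\<close> gives a continuous function on the
  full function space. There, for a countable index type and second countable values, the product
  sigma-algebra is the Borel one.\<close>

lemma borel_measurable_continuous_map_PiM:
  fixes f :: "('i::countable \<Rightarrow> 'b::second_countable_topology) \<Rightarrow> 'c::topological_space"
  assumes "continuous_map (product_topology (\<lambda>_. euclidean) I) euclidean f"
  shows "f \<in> borel_measurable (Pi\<^sub>M I (\<lambda>_. borel))"
proof -
  have "continuous_map (product_topology (\<lambda>_. euclidean) UNIV)
          (product_topology (\<lambda>_. euclidean) I) (\<lambda>x :: 'i \<Rightarrow> 'b. restrict x I)"
    by (auto simp: continuous_map_componentwise intro: continuous_map_product_projection)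
  from continuous_map_compose[OF this assms]
  have "continuous_on UNIV (\<lambda>x. f (restrict x I))"
    by (simp add: euclidean_product_topology o_def)
  then have "(\<lambda>x. f (restrict x I)) \<in> borel_measurable (Pi\<^sub>M UNIV (\<lambda>_. borel))"
    by (subst measurable_cong_sets[OF sets_PiM_equal_borel refl])
      (rule borel_measurable_continuous_onI)
  \<comment> \<open>The identity embeds the extensional functions into all functions. Coordinates
    outside \<open>I\<close> are constantly \<open>undefined\<close> there, hence
    measurable.\<close>
  moreover have "(\<lambda>x i. x i) \<in> Pi\<^sub>M I (\<lambda>_. borel) \<rightarrow>\<^sub>M Pi\<^sub>M UNIV (\<lambda>_. borel :: 'b measure)"
  proof (rule measurable_PiM_single')
    fix i :: 'i
    show "(\<lambda>x. x i) \<in> borel_measurable (Pi\<^sub>M I (\<lambda>_. borel :: 'b measure))"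
    proof (cases "i \<in> I")
      case False
      then have "(\<lambda>x. x i) \<in> borel_measurable (Pi\<^sub>M I (\<lambda>_. borel :: 'b measure)) \<longleftrightarrow>
          (\<lambda>x. undefined :: 'b) \<in> borel_measurable (Pi\<^sub>M I (\<lambda>_. borel :: 'b measure))"
        by (intro measurable_cong) (auto simp: space_PiM PiE_def extensional_def)
      then show ?thesis
        by simp
    qed simp
  qed auto
  ultimately have "(\<lambda>x. f (restrict x I)) \<in> borel_measurable (Pi\<^sub>M I (\<lambda>_. borel))"
    by (rule measurable_compose_rev)
  then show ?thesis
    by (rule measurable_cong[THEN iffD1, rotated])
      (auto simp: space_PiM PiE_def extensional_restrict)
qed

text \<open>Both measures give a box the product of the masses of the preimages of its sides, and
  boxes determine a finite product of probability measures.\<close>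

lemma distr_PiM_coordinatewise:
  assumes fin: "finite I"
    and prob: "\<And>i. i \<in> I \<Longrightarrow> prob_space (M i)"
    and meas[measurable]: "\<And>i. i \<in> I \<Longrightarrow> f i \<in> M i \<rightarrow>\<^sub>M N i"
  shows "distr (Pi\<^sub>M I M) (Pi\<^sub>M I N) (\<lambda>\<omega>. \<lambda>i\<in>I. f i (\<omega> i)) =
    Pi\<^sub>M I (\<lambda>i. distr (M i) (N i) (f i))"
proof -
  \<comment> \<open>The locale \<open>product_prob_space\<close> asks for a probability measure at
    every index. A point mass fills the indices outside \<open>I\<close>, which products over
    \<open>I\<close> do not see.\<close>
  define M' where "M' i = (if i \<in> I then M i else return (count_space UNIV) undefined)" for i
  define L where "L i = (if i \<in> I then distr (M i) (N i) (f i)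
    else return (count_space UNIV) undefined)" for i
  interpret M': product_prob_space M'
    by (rule product_prob_spaceI) (auto simp: M'_def prob intro!: prob_space_return)
  interpret L: product_prob_space L
    by (rule product_prob_spaceI)
      (auto simp: L_def intro!: prob_space_return prob_space.prob_space_distr prob meas)
  have M': "Pi\<^sub>M I M = Pi\<^sub>M I M'" and L: "Pi\<^sub>M I (\<lambda>i. distr (M i) (N i) (f i)) = Pi\<^sub>M I L"
    by (intro PiM_cong; simp add: M'_def L_def)+
  have [measurable]: "(\<lambda>\<omega>. \<lambda>i\<in>I. f i (\<omega> i)) \<in> Pi\<^sub>M I M' \<rightarrow>\<^sub>M Pi\<^sub>M I N"
    unfolding M'[symmetric] by measurable
  show ?thesis
    unfolding M' L
  proof (rule L.PiM_eqI[OF fin])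
    show "sets (distr (Pi\<^sub>M I M') (Pi\<^sub>M I N) (\<lambda>\<omega>. \<lambda>i\<in>I. f i (\<omega> i))) = sets (Pi\<^sub>M I L)"
      unfolding sets_distr by (intro sets_PiM_cong) (auto simp: L_def)
    fix A assume A: "\<And>i. i \<in> I \<Longrightarrow> A i \<in> sets (L i)"
    then have A': "A i \<in> sets (N i)" if "i \<in> I" for i
      using that by (force simp: L_def)
    have "emeasure (distr (Pi\<^sub>M I M') (Pi\<^sub>M I N) (\<lambda>\<omega>. \<lambda>i\<in>I. f i (\<omega> i))) (Pi\<^sub>E I A) =
        emeasure (Pi\<^sub>M I M') ((\<lambda>\<omega>. \<lambda>i\<in>I. f i (\<omega> i)) -` Pi\<^sub>E I A \<inter> space (Pi\<^sub>M I M'))"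
      using A' fin by (intro emeasure_distr sets_PiM_I_finite) auto
    also have "(\<lambda>\<omega>. \<lambda>i\<in>I. f i (\<omega> i)) -` Pi\<^sub>E I A \<inter> space (Pi\<^sub>M I M') =
        (\<Pi>\<^sub>E i\<in>I. f i -` A i \<inter> space (M' i))"
      by (auto simp: space_PiM PiE_iff)
    also have "emeasure (Pi\<^sub>M I M') \<dots> = (\<Prod>i\<in>I. emeasure (M' i) (f i -` A i \<inter> space (M' i)))"
      using A' fin by (intro M'.emeasure_PiM) (auto simp: M'_def intro!: measurable_sets[OF meas])
    also have "\<dots> = (\<Prod>i\<in>I. emeasure (L i) (A i))"
      using A' by (intro prod.cong) (auto simp: M'_def L_def emeasure_distr)
    finally show "emeasure (distr (Pi\<^sub>M I M') (Pi\<^sub>M I N) (\<lambda>\<omega>. \<lambda>i\<in>I. f i (\<omega> i))) (Pi\<^sub>E I A) =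
        (\<Prod>i\<in>I. emeasure (L i) (A i))" .
  qed
qed

text \<open>
  A continuous mapping theorem for product measures, in which the mapping may also vary with the
  index: realise each coordinate almost surely by Skorohod's theorem and use dominated convergence.
\<close>

lemma tendsto_integral_PiM_weak_conv:
  fixes \<mu> :: "nat \<Rightarrow> 'i \<Rightarrow> real measure" and \<nu> :: "'i \<Rightarrow> real measure"
    and h :: "nat \<Rightarrow> ('i \<Rightarrow> real) \<Rightarrow> real"
  assumes fin: "finite I"
    and \<mu>: "\<And>k i. i \<in> I \<Longrightarrow> real_distribution (\<mu> k i)"
    and \<nu>: "\<And>i. i \<in> I \<Longrightarrow> real_distribution (\<nu> i)"
    and conv: "\<And>i. i \<in> I \<Longrightarrow> weak_conv_m (\<lambda>k. \<mu> k i) (\<nu> i)"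
    and h[measurable]: "\<And>k. h k \<in> borel_measurable (Pi\<^sub>M I (\<lambda>_. borel))"
    and h'[measurable]: "h' \<in> borel_measurable (Pi\<^sub>M I (\<lambda>_. borel))"
    and bound: "\<And>k y. y \<in> Pi\<^sub>E I (\<lambda>_. UNIV) \<Longrightarrow> \<bar>h k y\<bar> \<le> B"
    and cont: "\<And>y y'. (\<And>i. i \<in> I \<Longrightarrow> (\<lambda>k. y k i) \<longlonglongrightarrow> y' i) \<Longrightarrow>
      (\<lambda>k. h k (restrict (y k) I)) \<longlonglongrightarrow> h' (restrict y' I)"
  shows "(\<lambda>k. \<integral>y. h k y \<partial>Pi\<^sub>M I (\<mu> k)) \<longlonglongrightarrow> (\<integral>y. h' y \<partial>Pi\<^sub>M I \<nu>)"
proof -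
  \<comment> \<open>Skorohod's theorem is applied to each coordinate separately; the coordinates are
    coupled only afterwards, by taking the product of the spaces obtained.\<close>
  have "\<forall>i\<in>I. \<exists>(\<Omega> :: real measure) Y Y'. prob_space \<Omega> \<and> (\<forall>k. Y k \<in> borel_measurable \<Omega>) \<and>
      (\<forall>k. distr \<Omega> borel (Y k) = \<mu> k i) \<and> Y' \<in> \<Omega> \<rightarrow>\<^sub>M lborel \<and> distr \<Omega> borel Y' = \<nu> i \<and>
      (\<forall>x \<in> space \<Omega>. (\<lambda>k. Y k x :: real) \<longlonglongrightarrow> Y' x)"
    using Skorohod[OF \<mu> \<nu> conv] by blast
  then obtain \<Omega> :: "'i \<Rightarrow> real measure" and Y Y' where
    Y: "\<forall>i\<in>I. prob_space (\<Omega> i) \<and> (\<forall>k. Y i k \<in> borel_measurable (\<Omega> i)) \<and>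
      (\<forall>k. distr (\<Omega> i) borel (Y i k) = \<mu> k i) \<and> Y' i \<in> \<Omega> i \<rightarrow>\<^sub>M lborel \<and> distr (\<Omega> i) borel (Y' i) = \<nu> i \<and>
      (\<forall>x \<in> space (\<Omega> i). (\<lambda>k. Y i k x :: real) \<longlonglongrightarrow> Y' i x)"
    by metis
  then have prob: "\<And>i. i \<in> I \<Longrightarrow> prob_space (\<Omega> i)"
    and Y_meas[measurable]: "\<And>i k. i \<in> I \<Longrightarrow> Y i k \<in> borel_measurable (\<Omega> i)"
    and Y'_meas[measurable]: "\<And>i. i \<in> I \<Longrightarrow> Y' i \<in> borel_measurable (\<Omega> i)"
    by auto
  interpret P: prob_space "Pi\<^sub>M I \<Omega>"
    by (rule prob_space_PiM) (rule prob)
  \<comment> \<open>All the product laws become images of one measure, so the integrals can be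
    compared pointwise.\<close>
  have \<mu>_eq: "Pi\<^sub>M I (\<mu> k) =
      distr (Pi\<^sub>M I \<Omega>) (Pi\<^sub>M I (\<lambda>_. borel)) (\<lambda>\<omega>. \<lambda>i\<in>I. Y i k (\<omega> i))" for k
    using Y by (subst distr_PiM_coordinatewise[OF fin]) (auto intro!: PiM_cong)
  have \<nu>_eq: "Pi\<^sub>M I \<nu> =
      distr (Pi\<^sub>M I \<Omega>) (Pi\<^sub>M I (\<lambda>_. borel)) (\<lambda>\<omega>. \<lambda>i\<in>I. Y' i (\<omega> i))"
    using Y by (subst distr_PiM_coordinatewise[OF fin]) (auto intro!: PiM_cong)
  have "(\<lambda>k. \<integral>\<omega>. h k (\<lambda>i\<in>I. Y i k (\<omega> i)) \<partial>Pi\<^sub>M I \<Omega>) \<longlonglongrightarrow>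
      (\<integral>\<omega>. h' (\<lambda>i\<in>I. Y' i (\<omega> i)) \<partial>Pi\<^sub>M I \<Omega>)"
  proof (rule integral_dominated_convergence[where w = "\<lambda>_. B"])
    show "AE \<omega> in Pi\<^sub>M I \<Omega>.
        (\<lambda>k. h k (\<lambda>i\<in>I. Y i k (\<omega> i))) \<longlonglongrightarrow> h' (\<lambda>i\<in>I. Y' i (\<omega> i))"
      using Y by (intro AE_I2 cont) (auto simp: space_PiM)
  qed (use bound in simp_all)
  then show ?thesis
    unfolding \<mu>_eq \<nu>_eq by (subst (1 2) integral_distr) simp_all
qed

section \<open>Minimum and soft minimum\<close>

lemma tendsto_Min_image:
  fixes f :: "'i \<Rightarrow> 'a \<Rightarrow> 'b::linorder_topology"
  assumes "finite A" "A \<noteq> {}" "\<And>i. i \<in> A \<Longrightarrow> ((\<lambda>x. f i x) \<longlongrightarrow> l i) F"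
  shows "((\<lambda>x. MIN i\<in>A. f i x) \<longlongrightarrow> (MIN i\<in>A. l i)) F"
  using assms by (induction A rule: finite_ne_induct) (auto intro!: tendsto_min)

text \<open>With \<open>m\<close> the minimum, the largest summand is \<open>exp (- m / t)\<close>,
  so the sum lies between it and \<open>card A\<close> times it. Applying \<open>- t * ln\<close>
  reverses the order.\<close>

lemma soft_Min_bounds:
  fixes w :: "'i \<Rightarrow> real"
  assumes "finite A" "A \<noteq> {}" "t > 0"
  shows "- t * ln (\<Sum>i\<in>A. exp (- w i / t)) \<le> (MIN i\<in>A. w i)"
    and "(MIN i\<in>A. w i) - t * ln (card A) \<le> - t * ln (\<Sum>i\<in>A. exp (- w i / t))"
proof -
  define m where "m = (MIN i\<in>A. w i)"
  let ?S = "\<Sum>i\<in>A. exp (- w i / t)"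
  have "m \<in> w ` A"
    unfolding m_def using assms by (intro Min_in) auto
  then obtain j where j: "j \<in> A" "w j = m"
    by auto
  have "exp (- m / t) \<le> ?S"
    using j assms by (intro member_le_sum[of j A "\<lambda>i. exp (- w i / t)", simplified j]) auto
  then have "- m / t \<le> ln ?S"
    by (subst ln_ge_iff) (auto intro: less_le_trans[OF exp_gt_zero])
  then show "- t * ln ?S \<le> (MIN i\<in>A. w i)"
    using assms unfolding m_def[symmetric] by (simp add: field_simps)
  have "?S \<le> (\<Sum>i\<in>A. exp (- m / t))"
  proof (intro sum_mono)
    fix i assume "i \<in> A"
    then have "m \<le> w i"
      unfolding m_def using assms by (intro Min_le) auto
    then show "exp (- w i / t) \<le> exp (- m / t)"
      using assms by (simp add: divide_right_mono)
  qed
  then have "ln ?S \<le> ln (card A * exp (- m / t))"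
    using assms by (subst ln_le_cancel_iff) (auto intro!: sum_pos mult_pos_pos simp: card_gt_0_iff)
  also have "\<dots> = ln (card A) - m / t"
    using assms by (subst ln_mult) (auto simp: card_gt_0_iff)
  finally show "(MIN i\<in>A. w i) - t * ln (card A) \<le> - t * ln ?S"
    using assms unfolding m_def[symmetric] by (simp add: field_simps)
qed

text \<open>The two bounds squeeze the soft minimum, as the gap \<open>t x * ln (card A)\<close>
  vanishes with \<open>t x\<close>. Scale and exponents vary together because the log-increments
  converge while the time tends to 0.\<close>

lemma tendsto_soft_Min:
  fixes w :: "'a \<Rightarrow> 'i \<Rightarrow> real"
  assumes A: "finite A" "A \<noteq> {}"
    and t: "(t \<longlongrightarrow> 0) F" "\<forall>\<^sub>F x in F. t x > 0"
    and w: "\<And>i. i \<in> A \<Longrightarrow> ((\<lambda>x. w x i) \<longlongrightarrow> l i) F"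
  shows "((\<lambda>x. - t x * ln (\<Sum>i\<in>A. exp (- w x i / t x))) \<longlongrightarrow> (MIN i\<in>A. l i)) F"
proof (rule tendsto_sandwich)
  show "\<forall>\<^sub>F x in F. (MIN i\<in>A. w x i) - t x * ln (card A) \<le> - t x * ln (\<Sum>i\<in>A. exp (- w x i / t x))"
    using t(2) by (rule eventually_mono) (rule soft_Min_bounds(2)[OF A])
  show "\<forall>\<^sub>F x in F. - t x * ln (\<Sum>i\<in>A. exp (- w x i / t x)) \<le> (MIN i\<in>A. w x i)"
    using t(2) by (rule eventually_mono) (rule soft_Min_bounds(1)[OF A])
  show Min: "((\<lambda>x. MIN i\<in>A. w x i) \<longlongrightarrow> (MIN i\<in>A. l i)) F"
    using A w by (rule tendsto_Min_image)
  then have "((\<lambda>x. (MIN i\<in>A. w x i) - t x * ln (card A)) \<longlongrightarrow> (MIN i\<in>A. l i) - 0 * ln (card A)) F"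
    by (intro tendsto_intros t)
  then show "((\<lambda>x. (MIN i\<in>A. w x i) - t x * ln (card A)) \<longlongrightarrow> (MIN i\<in>A. l i)) F"
    by simp
qed

section \<open>Exponential laws\<close>

lemma real_distribution_exp_law: "\<gamma> > 0 \<Longrightarrow> real_distribution (exp_law \<gamma>)"
  unfolding exp_law_def real_distribution_def real_distribution_axioms_def
  by (auto intro: prob_space_exponential_density)

lemma distributed_id_exp_law:
  "\<gamma> > 0 \<Longrightarrow> distributed (exp_law \<gamma>) lborel (\<lambda>x. x) (exponential_density \<gamma>)"
  by (auto simp: distributed_def exp_law_def distr_id2)

text \<open>The exponential law is characterised by the mass of \<open>{..a}\<close> for
  \<open>a \<ge> 0\<close>, and \<open>x / \<gamma> \<le> a\<close> amounts to
  \<open>x \<le> a * \<gamma>\<close>.\<close>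

lemma distr_exp_law_divide:
  assumes "\<gamma> > 0"
  shows "distr (exp_law 1) borel (\<lambda>x. x / \<gamma>) = exp_law \<gamma>"
proof -
  interpret prob_space "exp_law 1"
    unfolding exp_law_def by (rule prob_space_exponential_density) simp
  have "distributed (exp_law 1) lborel (\<lambda>x. x / \<gamma>) (exponential_density \<gamma>)"
    using assms distributed_id_exp_law[of 1] unfolding exponential_distributed_iff[OF zero_less_one]
      exponential_distributed_iff[OF assms]
    by (auto simp: exp_law_def pos_divide_le_eq)
  then have "distr (exp_law 1) lborel (\<lambda>x. x / \<gamma>) = exp_law \<gamma>"
    by (simp add: distributed_def exp_law_def)
  \<comment> \<open>\<open>lborel\<close> and \<open>borel\<close> have the same space and sets, so
    they give the same \<open>distr\<close>.\<close>
  then show ?thesis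
    by (simp cong: distr_cong add: distr_def)
qed

lemma cdf_exp_law_0:
  assumes "\<gamma> > 0"
  shows "cdf (exp_law \<gamma>) 0 = 0"
proof -
  interpret real_distribution "exp_law \<gamma>"
    using assms by (rule real_distribution_exp_law)
  show ?thesis
    using exponential_distributedD_le[OF distributed_id_exp_law[OF assms] order_refl assms]
    by (simp add: cdf_def atMost_def)
qed

text \<open>Links convergence along a filter to the sequential notion: continuous test functions
  bounded by 1 suffice for the latter, and all of them are admissible in the former.\<close>

lemma converges_weakly_imp_weak_conv_m:
  assumes conv: "converges_weakly euclideanreal \<mu> \<nu> F"
    and x: "filterlim x F sequentially"
    and \<mu>: "\<And>k :: nat. real_distribution (\<mu> (x k))" and \<nu>: "real_distribution \<nu>"
  shows "weak_conv_m (\<lambda>k. \<mu> (x k)) \<nu>"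
proof (rule integral_bdd_continuous_conv_imp_weak_conv[OF \<mu> \<nu>])
  fix f :: "real \<Rightarrow> real"
  assume "\<And>x. isCont f x" "\<And>x. \<bar>f x\<bar> \<le> 1"
  then have "continuous_map euclideanreal euclideanreal f" "bounded (f ` topspace euclideanreal)"
    by (auto simp: continuous_on_eq_continuous_at bounded_iff)
  with conv have "((\<lambda>t. \<integral>x. f x \<partial>\<mu> t) \<longlongrightarrow> (\<integral>x. f x \<partial>\<nu>)) F"
    unfolding converges_weakly_def by blast
  from filterlim_compose[OF this x]
  show "(\<lambda>k. integral\<^sup>L (\<mu> (x k)) f) \<longlonglongrightarrow> integral\<^sup>L \<nu> f" .
qed

lemma sets_exp_law[simp, measurable_cong]: "sets (exp_law \<gamma>) = sets borel"
  by (simp add: exp_law_def)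

text \<open>A distribution function is continuous where its measure has no atom, and
  \<open>{0}\<close> lies in the null set \<open>{..0}\<close>. Weak convergence thus yields
  convergence of the distribution functions at 0.\<close>

lemma isCont_cdf_exp_law_0:
  assumes "\<gamma> > 0"
  shows "isCont (cdf (exp_law \<gamma>)) 0"
proof -
  interpret real_distribution "exp_law \<gamma>"
    using assms by (rule real_distribution_exp_law)
  have "measure (exp_law \<gamma>) {0} \<le> measure (exp_law \<gamma>) {..0}"
    by (intro finite_measure_mono) auto
  then show ?thesis
    using cdf_exp_law_0[OF assms] unfolding isCont_cdf by (simp add: cdf_def measure_le_0_iff)
qed

section \<open>The finite-dimensional limit law\<close>

text \<open>Moves the factor \<open>1 / \<gamma>\<close> into the rate and shifts the indices by
  one, so that coordinate \<open>i\<close> belongs to the increment between \<open>s i\<close> and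
  \<open>s (Suc i)\<close>.\<close>

lemma distr_extremal_vector:
  assumes "\<gamma> > 0"
  shows "distr (Pi\<^sub>M {1..n} (\<lambda>_. exp_law 1)) (Rn_borel n) (extremal_vector \<gamma> n s) =
    distr (Pi\<^sub>M {..<n} (\<lambda>_. exp_law \<gamma>)) (Rn_borel n)
      (\<lambda>w. \<lambda>k\<in>{1..n}. MIN i\<in>{..<k}. w i / (s (Suc i) - s i))"
    (is "_ = distr _ _ ?G")
proof -
  have prob: "prob_space (exp_law 1)"
    unfolding exp_law_def by (rule prob_space_exponential_density) simp
  have meas_G[measurable]: "?G \<in> Pi\<^sub>M {..<n} (\<lambda>_. borel) \<rightarrow>\<^sub>M Rn_borel n"
    by (intro measurable_restrict borel_measurable_Min borel_measurable_divide
        measurable_component_singleton) auto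
  have scale: "distr (Pi\<^sub>M {..<n} (\<lambda>_. exp_law 1)) (Pi\<^sub>M {..<n} (\<lambda>_. borel))
      (\<lambda>\<omega>. \<lambda>i\<in>{..<n}. \<omega> i / \<gamma>) = Pi\<^sub>M {..<n} (\<lambda>_. exp_law \<gamma>)"
    using assms
    by (subst distr_PiM_coordinatewise[where f = "\<lambda>_ x. x / \<gamma>"])
      (auto simp: prob distr_exp_law_divide)
  have reindex: "distr (Pi\<^sub>M {1..n} (\<lambda>_. exp_law 1)) (Pi\<^sub>M {..<n} (\<lambda>_. exp_law 1))
      (\<lambda>\<omega>. \<lambda>i\<in>{..<n}. \<omega> (Suc i)) = Pi\<^sub>M {..<n} (\<lambda>_. exp_law 1)"
    using distr_PiM_reindex[of "{1..n}" "\<lambda>_. exp_law 1" Suc "{..<n}"] by (auto simp: prob)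
  have "?G (\<lambda>i\<in>{..<n}. (\<lambda>i\<in>{..<n}. z (Suc i)) i / \<gamma>) = extremal_vector \<gamma> n s z" for z
  proof -
    have "(MIN i\<in>{..<k}. (\<lambda>i\<in>{..<n}. (\<lambda>i\<in>{..<n}. z (Suc i)) i / \<gamma>) i / (s (Suc i) - s i)) =
        1 / \<gamma> * (MIN i\<in>{1..k}. z i / (s i - s (i - 1)))" if k: "k \<in> {1..n}" for k
    proof -
      \<comment> \<open>A monotone map commutes with the minimum of a finite nonempty set.\<close>
      have "mono (\<lambda>x. 1 / \<gamma> * x)"
        using assms by (intro monoI mult_left_mono) auto
      then have "1 / \<gamma> * (MIN i\<in>{1..k}. z i / (s i - s (i - 1))) =
          Min ((\<lambda>x. 1 / \<gamma> * x) ` (\<lambda>i. z i / (s i - s (i - 1))) ` {1..k})"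
        using k by (intro mono_Min_commute) auto
      also have "\<dots> = (MIN i\<in>{..<k}. 1 / \<gamma> * (z (Suc i) / (s (Suc i) - s i)))"
        by (simp only: image_Suc_lessThan[symmetric] image_image diff_Suc_1)
      also have "\<dots> = (MIN i\<in>{..<k}. (\<lambda>i\<in>{..<n}. (\<lambda>i\<in>{..<n}. z (Suc i)) i / \<gamma>) i / (s (Suc i) - s i))"
        using k by (intro arg_cong[where f = Min] image_cong) auto
      finally show ?thesis ..
    qed
    then show ?thesis
      unfolding extremal_vector_def by (intro restrict_ext)
  qed
  then show ?thesis
    by (subst scale[symmetric], subst reindex[symmetric]) (simp add: distr_distr o_def)
qed

section \<open>Convergence for the subordinator\<close>

text \<open>The limit is taken on the canonical product space; the laws of an extremal process and
  of a vector built from any i.i.d. sequence are identified with it afterwards.\<close>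

lemma converges_weakly_extremal_vector:
  fixes X :: "real \<Rightarrow> 'a \<Rightarrow> real"
  assumes X: "pure_jump_subordinator M X" and "\<gamma> > 0"
    and conv: "converges_weakly euclideanreal (\<lambda>t. distr M borel (\<lambda>\<omega>. - t * ln (X t \<omega>)))
           (exp_law \<gamma>) (at_right 0)"
    and n: "n \<ge> 1" and s0: "s 0 = 0" and s: "strict_mono_on {0..n} s"
  shows "converges_weakly (Rn_top n) (\<lambda>t. fin_dim_distr M (log_scaled X t) n s)
    (distr (Pi\<^sub>M {1..n} (\<lambda>_. exp_law 1)) (Rn_borel n) (extremal_vector \<gamma> n s)) (at_right 0)"
  unfolding converges_weakly_def
proof (intro allI impI, elim conjE)
  fix f :: "(nat \<Rightarrow> real) \<Rightarrow> real"
  assume f: "continuous_map (Rn_top n) euclideanreal f" and f_bdd: "bounded (f ` topspace (Rn_top n))"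
  from X have levy: "levy_process M X"
    and mono: "AE \<omega> in M. mono_on {0..} (\<lambda>t. X t \<omega>)"
    by (auto simp: pure_jump_subordinator_def)
  then have X_meas[measurable]: "\<And>t. t \<ge> 0 \<Longrightarrow> X t \<in> borel_measurable M"
    and X_0: "AE \<omega> in M. X 0 \<omega> = 0"
    and stat: "\<And>t h. t \<ge> 0 \<Longrightarrow> h \<ge> 0 \<Longrightarrow>
      distr M borel (\<lambda>\<omega>. X (t + h) \<omega> - X t \<omega>) = distr M borel (X h)"
    by (auto simp: levy_process_def)
  interpret prob_space M
    using levy by (simp add: levy_process_def)
  have indep: "indep_vars (\<lambda>_. borel) (\<lambda>i \<omega>. X (t (Suc i)) \<omega> - X (t i) \<omega>) {..<n}"
    if "0 \<le> t 0" "strict_mono_on {0..n} t" for t :: "nat \<Rightarrow> real"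
    using levy that by (simp add: levy_process_def)
  define c where "c i = s (Suc i) - s i" for i
  have c: "c i > 0" if "i < n" for i
    using that s by (auto simp: c_def strict_mono_on_def)
  have s_nonneg: "s i \<ge> 0" if "i \<le> n" for i
    using that s s0 strict_mono_on_leD[OF s, of 0 i] by auto
  have f_meas[measurable]: "f \<in> borel_measurable (Rn_borel n)"
    using f by (rule borel_measurable_continuous_map_PiM)
  obtain B where B: "\<And>x. x \<in> extensional {1..n} \<Longrightarrow> \<bar>f x\<bar> \<le> B"
    using f_bdd by (auto simp: bounded_iff PiE_def)
  \<comment> \<open>\<open>G\<close> is the limiting map, and \<open>S t\<close> below is its soft
    version at scale \<open>t\<close>, which turns logarithms of increments into logarithms of
    partial sums.\<close>
  define G where "G w = (\<lambda>k\<in>{1..n}. MIN i\<in>{..<k}. w i / c i)" for w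
  have G_meas[measurable]: "G \<in> Pi\<^sub>M {..<n} (\<lambda>_. borel) \<rightarrow>\<^sub>M Rn_borel n"
    unfolding G_def by (intro measurable_restrict borel_measurable_Min borel_measurable_divide
        measurable_component_singleton) auto
  define S where "S t w = (\<lambda>k\<in>{1..n}. - t * ln (\<Sum>i<k. exp (- (w i / c i) / t)))"
    for t and w :: "nat \<Rightarrow> real"
  have S_meas[measurable]: "S t \<in> Pi\<^sub>M {..<n} (\<lambda>_. borel) \<rightarrow>\<^sub>M Rn_borel n" for t
    unfolding S_def by (intro measurable_restrict) measurable
  have G_ext: "G w \<in> extensional {1..n}" and S_ext: "S t w \<in> extensional {1..n}" for t w
    by (auto simp: G_def S_def)
  show "((\<lambda>t. \<integral>x. f x \<partial>fin_dim_distr M (log_scaled X t) n s) \<longlongrightarrow>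
      (\<integral>x. f x \<partial>distr (Pi\<^sub>M {1..n} (\<lambda>_. exp_law 1)) (Rn_borel n) (extremal_vector \<gamma> n s))) (at_right 0)"
    \<comment> \<open>Skorohod's theorem is about sequences, so the limit is tested on an arbitrary
      positive sequence tending to 0.\<close>
    unfolding tendsto_at_iff_sequentially
  proof (intro allI impI)
    fix \<tau> :: "nat \<Rightarrow> real"
    assume \<tau>_in: "\<forall>k. \<tau> k \<in> {0<..} - {0}" and \<tau>: "\<tau> \<longlonglongrightarrow> 0"
    have \<tau>_pos[simp]: "\<tau> k > 0" for k
      using \<tau>_in by auto
    then have \<tau>_nonzero[simp]: "\<tau> k \<noteq> 0" for k
      by (metis less_irrefl)
    define D where "D k i \<omega> = X (\<tau> k * s (Suc i)) \<omega> - X (\<tau> k * s i) \<omega>" for k i \<omega>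
    \<comment> \<open>The factor is the length \<open>\<tau> k * c i\<close> of the time interval,
      so by stationarity \<open>W k i\<close> has the law of \<open>- u * ln (X u)\<close> at
      \<open>u = \<tau> k * c i\<close>. Dividing by \<open>c i\<close> returns to the common scale
      \<open>\<tau> k\<close>.\<close>
    define W where "W k i \<omega> = - (\<tau> k * c i) * ln (D k i \<omega>)" for k i \<omega>
    have X_\<tau>_meas[measurable]: "X (\<tau> k * s i) \<in> borel_measurable M" if "i \<le> n" for k i
      using that s_nonneg by (intro X_meas) (simp add: less_imp_le)
    have D_meas[measurable]: "D k i \<in> borel_measurable M" if "i < n" for k i
      using that unfolding D_def by (intro borel_measurable_diff X_\<tau>_meas) auto
    have W_meas[measurable]: "W k i \<in> borel_measurable M" if "i < n" for k i
      using that unfolding W_def by measurable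
    have D_distr: "distr M borel (D k i) = distr M borel (X (\<tau> k * c i))" if "i < n" for k i
    proof -
      have "\<tau> k * s (Suc i) = \<tau> k * s i + \<tau> k * c i"
        by (simp add: c_def algebra_simps)
      then show ?thesis
        using stat[of "\<tau> k * s i" "\<tau> k * c i"] that s_nonneg[of i] c[of i]
        unfolding D_def by (simp add: less_imp_le)
    qed
    have W_distr: "distr M borel (W k i) =
        distr M borel (\<lambda>\<omega>. - (\<tau> k * c i) * ln (X (\<tau> k * c i) \<omega>))" if "i < n" for k i
    proof -
      have [measurable]: "X (\<tau> k * c i) \<in> borel_measurable M"
        using c[OF that] by (intro X_meas) (simp add: less_imp_le)
      have "distr (distr M borel (D k i)) borel (\<lambda>x. - (\<tau> k * c i) * ln x) =
          distr (distr M borel (X (\<tau> k * c i))) borel (\<lambda>x. - (\<tau> k * c i) * ln x)"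
        using D_distr[OF that] by simp
      then show ?thesis
        using that by (simp add: distr_distr o_def W_def[abs_def])
    qed
    have W_conv: "weak_conv_m (\<lambda>k. distr M borel (W k i)) (exp_law \<gamma>)" if "i < n" for i
      unfolding W_distr[OF that]
    proof (rule converges_weakly_imp_weak_conv_m[OF conv, where x = "\<lambda>k. \<tau> k * c i"])
      show "filterlim (\<lambda>k. \<tau> k * c i) (at_right 0) sequentially"
        using c[OF that] tendsto_mult_left_zero[OF \<tau>, of "c i"]
        by (auto simp: filterlim_at intro!: always_eventually)
      show "real_distribution (distr M borel (\<lambda>\<omega>. - (\<tau> k * c i) * ln (X (\<tau> k * c i) \<omega>)))" for k
        unfolding W_distr[OF that, symmetric] using that by (intro real_distribution_distr) auto
    qed (use \<open>\<gamma> > 0\<close> in \<open>rule real_distribution_exp_law\<close>)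
    \<comment> \<open>Independence of the increments makes the joint law a product;
      \<open>n \<ge> 1\<close> supplies the nonempty index set that this characterisation of
      independence asks for.\<close>
    have W_joint: "Pi\<^sub>M {..<n} (\<lambda>i. distr M borel (W k i)) =
        distr M (Pi\<^sub>M {..<n} (\<lambda>_. borel)) (\<lambda>\<omega>. \<lambda>i\<in>{..<n}. W k i \<omega>)" for k
    proof -
      have "0 \<le> \<tau> k * s 0" "strict_mono_on {0..n} (\<lambda>i. \<tau> k * s i)"
        using s by (auto simp: strict_mono_on_def s0)
      then have "indep_vars (\<lambda>_. borel) (D k) {..<n}"
        unfolding D_def[abs_def] by (rule indep[of "\<lambda>i. \<tau> k * s i"])
      then have "indep_vars (\<lambda>_. borel) (W k) {..<n}"
        unfolding W_def[abs_def] by (rule indep_vars_compose2) simp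
      then show ?thesis
        using n by (subst (asm) indep_vars_iff_distr_eq_PiM') (auto simp: lessThan_empty_iff)
    qed
    \<comment> \<open>\<open>?V k\<close> rebuilds \<open>?L k\<close> from the logarithms of the
      increments. Almost surely they agree unless some increment vanishes.\<close>
    let ?V = "\<lambda>k \<omega>. S (\<tau> k) (\<lambda>i\<in>{..<n}. W k i \<omega>)"
    let ?L = "\<lambda>k \<omega>. \<lambda>m\<in>{1..n}. log_scaled X (\<tau> k) (s m) \<omega>"
    have V_meas[measurable]: "?V k \<in> M \<rightarrow>\<^sub>M Rn_borel n" for k
      by (rule measurable_compose[OF _ S_meas]) (intro measurable_restrict, auto)
    have L_meas[measurable]: "?L k \<in> M \<rightarrow>\<^sub>M Rn_borel n" for k
      unfolding log_scaled_def by (intro measurable_restrict) auto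
    have "(\<lambda>k. \<integral>w. f (S (\<tau> k) w) \<partial>Pi\<^sub>M {..<n} (\<lambda>i. distr M borel (W k i))) \<longlonglongrightarrow>
        (\<integral>w. f (G w) \<partial>Pi\<^sub>M {..<n} (\<lambda>_. exp_law \<gamma>))"
    proof (rule tendsto_integral_PiM_weak_conv[where B = B])
      fix w :: "nat \<Rightarrow> nat \<Rightarrow> real" and w'
      assume w: "\<And>i. i \<in> {..<n} \<Longrightarrow> (\<lambda>k. w k i) \<longlonglongrightarrow> w' i"
      \<comment> \<open>Convergence in the product topology is coordinatewise, and coordinate
        \<open>m\<close> is a soft minimum over the first \<open>m\<close> increments.\<close>
      have "limitin (Rn_top n) (\<lambda>k. S (\<tau> k) (restrict (w k) {..<n})) (G (restrict w' {..<n})) sequentially"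
        unfolding limitin_componentwise
      proof (intro conjI ballI)
        fix m assume m: "m \<in> {1..n}"
        have "(\<lambda>k. - \<tau> k * ln (\<Sum>i\<in>{..<m}. exp (- (restrict (w k) {..<n} i / c i) / \<tau> k))) \<longlonglongrightarrow>
            (MIN i\<in>{..<m}. restrict w' {..<n} i / c i)"
        proof (rule tendsto_soft_Min[OF _ _ \<tau>])
          fix i assume "i \<in> {..<m}"
          then have "i < n"
            using m by auto
          then show "(\<lambda>k. restrict (w k) {..<n} i / c i) \<longlonglongrightarrow> restrict w' {..<n} i / c i"
            using w[of i] c[of i] by (auto intro!: tendsto_divide)
        qed (use m in \<open>auto simp: lessThan_empty_iff\<close>)
        then show "limitin euclideanreal (\<lambda>k. S (\<tau> k) (restrict (w k) {..<n}) m)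
            (G (restrict w' {..<n}) m) sequentially"
          using m by (simp add: S_def G_def)
      qed (simp_all add: G_ext S_ext PiE_def del: One_nat_def)
      from continuous_map_limit[OF f this]
      show "(\<lambda>k. f (S (\<tau> k) (restrict (w k) {..<n}))) \<longlonglongrightarrow> f (G (restrict w' {..<n}))"
        by (simp add: o_def)
    qed (use \<open>\<gamma> > 0\<close> in \<open>auto intro: real_distribution_exp_law W_conv B S_ext simp del: One_nat_def\<close>)
    then have lim_V: "(\<lambda>k. \<integral>\<omega>. f (?V k \<omega>) \<partial>M) \<longlonglongrightarrow>
        (\<integral>w. f (G w) \<partial>Pi\<^sub>M {..<n} (\<lambda>_. exp_law \<gamma>))"
      unfolding W_joint by (subst (asm) integral_distr) auto
    have lim_diff: "(\<lambda>k. (\<integral>\<omega>. f (?L k \<omega>) \<partial>M) - (\<integral>\<omega>. f (?V k \<omega>) \<partial>M)) \<longlonglongrightarrow> 0"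
    proof (rule Lim_null_comparison)
      \<comment> \<open>The event \<open>W k i \<omega> \<le> 0\<close> also contains increments
        that are at least 1, but its probability is the distribution function of
        \<open>W k i\<close> at 0, which tends to 0.\<close>
      have le: "AE \<omega> in M. \<bar>f (?L k \<omega>) - f (?V k \<omega>)\<bar> \<le> (\<Sum>i<n. 2 * B * indicator {..0} (W k i \<omega>))" for k
        using mono X_0
      proof eventually_elim
        case (elim \<omega>)
        have D_nonneg: "D k i \<omega> \<ge> 0" if "i < n" for i
          using that s_nonneg[of i] s_nonneg[of "Suc i"] c[OF that] mono_onD[OF elim(1)]
          by (auto simp: D_def c_def less_imp_le)
        \<comment> \<open>Any extensional function shows this; a value of \<open>G\<close> is at
          hand.\<close>
        have "B \<ge> 0"
          using B[OF G_ext] by (meson abs_ge_zero order_trans)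
        show ?case
        proof (cases "\<forall>i<n. D k i \<omega> > 0")
          case True
          \<comment> \<open>On positive increments \<open>exp\<close> undoes \<open>ln\<close>, and
            the increments telescope to \<open>X (\<tau> k * s m)\<close> because \<open>X 0\<close>
            vanishes.\<close>
          have "- \<tau> k * ln (\<Sum>i<m. exp (- ((\<lambda>i\<in>{..<n}. W k i \<omega>) i / c i) / \<tau> k)) =
              log_scaled X (\<tau> k) (s m) \<omega>" if m: "m \<in> {1..n}" for m
          proof -
            have "(\<Sum>i<m. exp (- ((\<lambda>i\<in>{..<n}. W k i \<omega>) i / c i) / \<tau> k)) = (\<Sum>i<m. D k i \<omega>)"
            proof (rule sum.cong)
              fix i assume "i \<in> {..<m}"
              then have "i < n"
                using m by auto
              then show "exp (- ((\<lambda>i\<in>{..<n}. W k i \<omega>) i / c i) / \<tau> k) = D k i \<omega>"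
                using True c[of i] \<tau>_pos[of k] by (simp add: W_def)
            qed simp
            also have "\<dots> = X (\<tau> k * s m) \<omega>"
              unfolding D_def using sum_lessThan_telescope[of "\<lambda>i. X (\<tau> k * s i) \<omega>" m]
              by (simp add: s0 elim(2))
            finally show ?thesis
              by (simp add: log_scaled_def)
          qed
          then have "?V k \<omega> = ?L k \<omega>"
            unfolding S_def by (intro restrict_ext)
          then show ?thesis
            using \<open>B \<ge> 0\<close> by (auto intro!: sum_nonneg)
        next
          case False
          \<comment> \<open>Since \<open>ln 0 = 0\<close>, a vanishing increment shows up as \<open>W k j \<omega> = 0\<close>.\<close>
          then obtain j where j: "j < n" "D k j \<omega> = 0"
            using D_nonneg by (metis less_eq_real_def)
          have "\<bar>f (?L k \<omega>) - f (?V k \<omega>)\<bar> \<le> 2 * B"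
            using B[of "?L k \<omega>"] B[OF S_ext, of "\<tau> k" "\<lambda>i\<in>{..<n}. W k i \<omega>"] by (auto simp del: One_nat_def)
          also have "\<dots> = 2 * B * indicator {..0} (W k j \<omega>)"
            using j by (simp add: W_def)
          also have "\<dots> \<le> (\<Sum>i<n. 2 * B * indicator {..0} (W k i \<omega>))"
            using j \<open>B \<ge> 0\<close> by (intro member_le_sum) auto
          finally show ?thesis .
        qed
      qed
      have "\<bar>(\<integral>\<omega>. f (?L k \<omega>) \<partial>M) - (\<integral>\<omega>. f (?V k \<omega>) \<partial>M)\<bar> \<le>
          (\<Sum>i<n. 2 * B * cdf (distr M borel (W k i)) 0)" for k
      proof -
        have int: "integrable M (\<lambda>\<omega>. f (?L k \<omega>))" "integrable M (\<lambda>\<omega>. f (?V k \<omega>))"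
          by (intro integrable_const_bound[where B = B] AE_I2; simp add: B S_ext del: One_nat_def)+
        have ind: "integrable M (\<lambda>\<omega>. 2 * B * indicator {..0} (W k i \<omega>))"
          and ind_eq: "(\<integral>\<omega>. 2 * B * indicator {..0} (W k i \<omega>) \<partial>M) = 2 * B * cdf (distr M borel (W k i)) 0"
          if "i < n" for i
        proof -
          have [measurable]: "W k i \<in> borel_measurable M"
            using that by (rule W_meas)
          show "integrable M (\<lambda>\<omega>. 2 * B * indicator {..0} (W k i \<omega>))"
            by (intro integrable_mult_right integrable_const_bound[where B = 1]) auto
          have "(\<integral>\<omega>. indicator {..0} (W k i \<omega>) \<partial>M) = (\<integral>x. indicat_real {..0} x \<partial>distr M borel (W k i))"
            by (subst integral_distr) auto
          also have "\<dots> = cdf (distr M borel (W k i)) 0"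
            by (simp add: cdf_def)
          finally show "(\<integral>\<omega>. 2 * B * indicator {..0} (W k i \<omega>) \<partial>M) =
              2 * B * cdf (distr M borel (W k i)) 0"
            by simp
        qed
        have "\<bar>(\<integral>\<omega>. f (?L k \<omega>) \<partial>M) - (\<integral>\<omega>. f (?V k \<omega>) \<partial>M)\<bar> \<le>
            (\<integral>\<omega>. \<bar>f (?L k \<omega>) - f (?V k \<omega>)\<bar> \<partial>M)"
          using int integral_abs_bound[of M "\<lambda>\<omega>. f (?L k \<omega>) - f (?V k \<omega>)"] by simp
        also have "\<dots> \<le> (\<integral>\<omega>. (\<Sum>i<n. 2 * B * indicator {..0} (W k i \<omega>)) \<partial>M)"
          by (intro integral_mono_AE integrable_abs Bochner_Integration.integrable_diff
              Bochner_Integration.integrable_sum int ind le) simp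
        also have "\<dots> = (\<Sum>i<n. 2 * B * cdf (distr M borel (W k i)) 0)"
          by (subst Bochner_Integration.integral_sum) (use ind ind_eq in \<open>auto intro!: sum.cong\<close>)
        finally show ?thesis .
      qed
      then show "\<forall>\<^sub>F k in sequentially. norm ((\<integral>\<omega>. f (?L k \<omega>) \<partial>M) - (\<integral>\<omega>. f (?V k \<omega>) \<partial>M)) \<le>
          (\<Sum>i<n. 2 * B * cdf (distr M borel (W k i)) 0)"
        by simp
      \<comment> \<open>The limit law has no mass in \<open>{..0}\<close> and 0 is a continuity
        point, so the error bound vanishes.\<close>
      have "(\<lambda>k. cdf (distr M borel (W k i)) 0) \<longlonglongrightarrow> 0" if "i < n" for i
      proof -
        have "isCont (cdf (exp_law \<gamma>)) 0"
          using isCont_cdf_exp_law_0 \<open>\<gamma> > 0\<close> by blast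
        then show ?thesis
          using W_conv[OF that] cdf_exp_law_0[OF \<open>\<gamma> > 0\<close>]
          unfolding weak_conv_m_def weak_conv_def by metis
      qed
      then show "(\<lambda>k. \<Sum>i<n. 2 * B * cdf (distr M borel (W k i)) 0) \<longlonglongrightarrow> 0"
        by (intro tendsto_null_sum tendsto_mult_right_zero) auto
    qed
    have G_meas': "G \<in> Pi\<^sub>M {..<n} (\<lambda>_. exp_law \<gamma>) \<rightarrow>\<^sub>M Rn_borel n"
      by (subst measurable_cong_sets[OF sets_PiM_cong[OF refl sets_exp_law] refl]) (rule G_meas)
    from tendsto_add[OF lim_diff lim_V]
    have "(\<lambda>k. \<integral>\<omega>. f (?L k \<omega>) \<partial>M) \<longlonglongrightarrow> (\<integral>w. f (G w) \<partial>Pi\<^sub>M {..<n} (\<lambda>_. exp_law \<gamma>))"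
      by simp
    then show "((\<lambda>t. \<integral>x. f x \<partial>fin_dim_distr M (log_scaled X t) n s) \<circ> \<tau>) \<longlonglongrightarrow>
        (\<integral>x. f x \<partial>distr (Pi\<^sub>M {1..n} (\<lambda>_. exp_law 1)) (Rn_borel n) (extremal_vector \<gamma> n s))"
      unfolding distr_extremal_vector[OF \<open>\<gamma> > 0\<close>] fin_dim_distr_def o_def
        c_def[symmetric] G_def[symmetric]
      by (simp only: integral_distr[OF L_meas f_meas] integral_distr[OF G_meas' f_meas])
  qed
qed

section \<open>The two descriptions of the limit\<close>

theorem mainTheorem2:
  fixes M :: "'a measure" and X :: "real \<Rightarrow> 'a \<Rightarrow> real" and \<gamma> :: real
    and Q :: "'b measure" and \<eta> :: "real \<Rightarrow> 'b \<Rightarrow> real"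
    and P :: "'c measure" and Z :: "nat \<Rightarrow> 'c \<Rightarrow> real"
  assumes "pure_jump_subordinator M X"
    and "\<gamma> > 0"
    and "converges_weakly euclideanreal (\<lambda>t. distr M borel (\<lambda>\<omega>. - t * ln (X t \<omega>)))
           (exp_law \<gamma>) (at_right 0)"
  shows "(extremal_process \<gamma> Q \<eta> \<longrightarrow>
      (\<forall>n\<ge>1. \<forall>s :: nat \<Rightarrow> real. s 0 = 0 \<and> strict_mono_on {0..n} s \<longrightarrow>
        converges_weakly (Rn_top n) (\<lambda>t. fin_dim_distr M (log_scaled X t) n s)
          (fin_dim_distr Q \<eta> n s) (at_right 0))) \<and>
      (prob_space P \<and> prob_space.indep_vars P (\<lambda>_. borel) Z {1..} \<and>
        (\<forall>i\<ge>1. distributed P lborel (Z i) (exponential_density 1)) \<longrightarrow>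
      (\<forall>n\<ge>1. \<forall>s :: nat \<Rightarrow> real. s 0 = 0 \<and> strict_mono_on {0..n} s \<longrightarrow>
        converges_weakly (Rn_top n) (\<lambda>t. fin_dim_distr M (log_scaled X t) n s)
          (distr P (Rn_borel n) (\<lambda>\<omega>. extremal_vector \<gamma> n s (\<lambda>i. Z i \<omega>))) (at_right 0)))"
proof (intro conjI impI allI; elim conjE)
  fix n :: nat and s :: "nat \<Rightarrow> real"
  assume "extremal_process \<gamma> Q \<eta>" and s: "n \<ge> 1" "s 0 = 0" "strict_mono_on {0..n} s"
  then have "fin_dim_distr Q \<eta> n s =
      distr (Pi\<^sub>M {1..n} (\<lambda>_. exp_law 1)) (Rn_borel n) (extremal_vector \<gamma> n s)"
    unfolding extremal_process_def by blast
  then show "converges_weakly (Rn_top n) (\<lambda>t. fin_dim_distr M (log_scaled X t) n s)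
      (fin_dim_distr Q \<eta> n s) (at_right 0)"
    using converges_weakly_extremal_vector[OF assms s] by simp
next
  fix n :: nat and s :: "nat \<Rightarrow> real"
  assume s: "n \<ge> 1" "s 0 = 0" "strict_mono_on {0..n} s" and "prob_space P"
    and indep: "prob_space.indep_vars P (\<lambda>_. borel) Z {1..}"
    and Z: "\<forall>i\<ge>1. distributed P lborel (Z i) (exponential_density 1)"
  interpret P: prob_space P by fact
  have Z_meas[measurable]: "Z i \<in> borel_measurable P" if "i \<ge> 1" for i
    using Z that by (auto simp: distributed_def)
  have Z_distr: "distr P borel (Z i) = exp_law 1" if "i \<ge> 1" for i
    using Z that by (simp add: distributed_def exp_law_def distr_def cong: distr_cong)
  have ev_meas[measurable]: "extremal_vector \<gamma> n s \<in> Pi\<^sub>M {1..n} (\<lambda>_. borel) \<rightarrow>\<^sub>M Rn_borel n"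
    unfolding extremal_vector_def[abs_def]
    by (intro measurable_restrict borel_measurable_times borel_measurable_Min
        borel_measurable_divide measurable_component_singleton) auto
  \<comment> \<open>The first \<open>n\<close> variables alone enter the vector, and their joint law
    is the canonical product.\<close>
  have "P.indep_vars (\<lambda>_. borel) Z {1..n}"
    using indep by (rule P.indep_vars_subset) auto
  then have "distr P (Pi\<^sub>M {1..n} (\<lambda>_. borel)) (\<lambda>\<omega>. \<lambda>i\<in>{1..n}. Z i \<omega>) =
      Pi\<^sub>M {1..n} (\<lambda>i. distr P borel (Z i))"
    using s by (subst (asm) P.indep_vars_iff_distr_eq_PiM') auto
  also have "\<dots> = Pi\<^sub>M {1..n} (\<lambda>_. exp_law 1)"
    by (intro PiM_cong) (auto simp: Z_distr)
  finally have joint: "Pi\<^sub>M {1..n} (\<lambda>_. exp_law 1) =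
      distr P (Pi\<^sub>M {1..n} (\<lambda>_. borel)) (\<lambda>\<omega>. \<lambda>i\<in>{1..n}. Z i \<omega>)" ..
  \<comment> \<open>Coordinates outside \<open>{1..n}\<close> are never read, so the restricted
    vector of the product space may be replaced by the whole sequence.\<close>
  have "extremal_vector \<gamma> n s (\<lambda>i\<in>{1..n}. z i) = extremal_vector \<gamma> n s z" for z
    unfolding extremal_vector_def
    by (intro restrict_ext arg_cong[where f = "\<lambda>x. 1 / \<gamma> * Min x"] image_cong) auto
  then have "distr (Pi\<^sub>M {1..n} (\<lambda>_. exp_law 1)) (Rn_borel n) (extremal_vector \<gamma> n s) =
      distr P (Rn_borel n) (\<lambda>\<omega>. extremal_vector \<gamma> n s (\<lambda>i. Z i \<omega>))"
    unfolding joint by (subst distr_distr[OF ev_meas]) (auto simp: o_def intro!: measurable_restrict)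
  then show "converges_weakly (Rn_top n) (\<lambda>t. fin_dim_distr M (log_scaled X t) n s)
      (distr P (Rn_borel n) (\<lambda>\<omega>. extremal_vector \<gamma> n s (\<lambda>i. Z i \<omega>))) (at_right 0)"
    using converges_weakly_extremal_vector[OF assms s] by simp
qed

end
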